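(* Let $d\ge 2$, $\alpha>0$, $\kappa\in\mathbb R$, $\mu\in\mathbb S^{d-1}$, and let the random unit vector $Z\in\mathbb S^{d-1}$ have the axial distribution $\mathrm{GvMF}_{3,d}(\alpha,\kappa,\mu)$. Then $Z$ has the maximum entropy among all continuous random vectors $X$ on $\mathbb S^{d-1}$ (i.e. having a density with respect to $\sigma$) satisfying $$\mathbf E|\mu^{T}X|^{\alpha}=\mathbf E|\mu^{T}Z|^{\alpha};$$ that is, $H(X)\le H(Z)$ for every such $X$.
   Context: $\mathbb S^{d-1}=\{x\in\mathbb R^d:\|x\|=1\}$ and $\sigma$ is the (unnormalized) surface measure on $\mathbb S^{d-1}$, so that for unit $a$ and Borel $g\ge0$, $\int_{\mathbb S^{d-1}}g(a^{T}x)\,\sigma(dx)=\frac{2\pi^{(d-1)/2}}{\Gamma((d-1)/2)}\int_{-1}^1g(y)(1-y^2)^{(d-3)/2}dy$. $\mathrm{GvMF}_{3,d}(\alpha,\kappa,\mu)$ is the distribution on $\mathbb S^{d-1}$ with density with respect to $\sigma$ equal to $c_{3,d}(\kappa,\alpha)\exp\left(\frac{\kappa}{\alpha}|\mu^{T}x|^{\alpha}\right)$, where $c_{3,d}(\kappa,\alpha)=\left(\frac{4\pi^{(d-1)/2}}{\Gamma((d-1)/2)}\int_0^1e^{\frac\kappa\alpha y^\alpha}(1-y^2)^{\frac{d-3}{2}}dy\right)^{-1}$. The entropy of a random vector $X$ on $\mathbb S^{d-1}$ with density $f$ with respect to $\sigma$ is $H(X)=-\int_{\mathbb S^{d-1}}f(x)\log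 f(x)\,\sigma(dx)\in[-\infty,\infty)$, the integral being taken over $\{f>0\}$. *)

theory Defs
  imports "HOL-Probability.Probability"
begin

text \<open>
  The surface measure on the unit sphere of a Euclidean space is defined as the cone measure
  \<open>\<sigma>(A) = d * Leb {r *\<^sub>R x | 0 < r \<le> 1, x \<in> A}\<close>, see \<open>emeasure_sphere_measure\<close> below.
  It is a measure with space \<open>sphere 0 1\<close>; recall that \<open>sgn x = x /\<^sub>R norm x\<close>.
\<close>

definition sphere_measure :: "'a::euclidean_space measure" where
  "sphere_measure =
     scale_measure (of_nat DIM('a))
       (distr (restrict_space lborel (cball 0 1 - {0})) (restrict_space borel (sphere 0 1)) sgn)"

lemma space_sphere_measure [simp]: "space sphere_measure = sphere 0 1"
  by (simp add: sphere_measure_def space_scale_measure space_restrict_space)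

lemma sets_sphere_measure [measurable_cong, simp]:
  "sets sphere_measure = sets (restrict_space borel (sphere 0 1))"
  by (simp add: sphere_measure_def)

lemma sgn_measurable_sphere:
  "(sgn :: 'a::euclidean_space \<Rightarrow> 'a) \<in>
     restrict_space lborel (cball 0 1 - {0}) \<rightarrow>\<^sub>M restrict_space borel (sphere 0 1)"
proof (rule measurable_restrict_space2)
  show "sgn \<in> space (restrict_space lborel (cball 0 1 - {0})) \<rightarrow> sphere (0::'a) 1"
    by (auto simp: space_restrict_space norm_sgn)
  have "(sgn :: 'a \<Rightarrow> 'a) = (\<lambda>x. x /\<^sub>R norm x)"
    by (simp add: fun_eq_iff sgn_div_norm)
  then have "(sgn :: 'a \<Rightarrow> 'a) \<in> borel \<rightarrow>\<^sub>M borel"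
    by simp
  then show "(sgn :: 'a \<Rightarrow> 'a) \<in> restrict_space lborel (cball 0 1 - {0}) \<rightarrow>\<^sub>M borel"
    by (intro measurable_restrict_space1) simp
qed

lemma emeasure_sphere_measure:
  fixes A :: "'a::euclidean_space set"
  assumes "A \<in> sets borel" "A \<subseteq> sphere 0 1"
  shows "emeasure sphere_measure A =
           of_nat DIM('a) * emeasure lborel {r *\<^sub>R x | r x. 0 < r \<and> r \<le> 1 \<and> x \<in> A}"
proof -
  have A: "A \<in> sets (restrict_space borel (sphere 0 1))"
    using assms by (subst sets_restrict_space_iff) auto
  have eq: "sgn -` A \<inter> (cball 0 1 - {0}) = {r *\<^sub>R x | r x. 0 < r \<and> r \<le> 1 \<and> x \<in> A}"
    (is "?L = ?R")
  proof (intro set_eqI iffI)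
    fix y assume "y \<in> ?L"
    then show "y \<in> ?R"
      by (auto simp: sgn_div_norm intro!: exI[of _ "norm y"] exI[of _ "y /\<^sub>R norm y"])
  next
    fix y assume "y \<in> ?R"
    then obtain r x where "y = r *\<^sub>R x" "0 < r" "r \<le> 1" "x \<in> A" by blast
    moreover from this have "norm x = 1" using assms(2) by auto
    ultimately show "y \<in> ?L" by (auto simp: sgn_div_norm)
  qed
  show ?thesis
    unfolding sphere_measure_def
    by (simp add: emeasure_distr[OF sgn_measurable_sphere A] space_restrict_space eq[symmetric]
        emeasure_restrict_space)
qed

lemma emeasure_sphere_measure_space:
  "emeasure (sphere_measure :: 'a::euclidean_space measure) (sphere 0 1) =
     ennreal (2 * pi powr (DIM('a) / 2) / Gamma (DIM('a) / 2))"
proof -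
  let ?B = "{r *\<^sub>R x | r x. 0 < r \<and> r \<le> 1 \<and> x \<in> sphere (0::'a) 1}"
  have B: "?B = cball 0 1 - {0}"
  proof (intro set_eqI iffI)
    fix y :: 'a assume "y \<in> cball 0 1 - {0}"
    then show "y \<in> ?B"
      by (auto intro!: exI[of _ "norm y"] exI[of _ "y /\<^sub>R norm y"])
  qed auto
  have "emeasure lborel (cball (0::'a) 1 - {0}) = emeasure lborel (cball (0::'a) 1)"
    by (subst emeasure_Diff) auto
  also have "\<dots> = ennreal (unit_ball_vol DIM('a))"
    using emeasure_cball[of 1 "0::'a"] by simp
  finally have "emeasure (sphere_measure :: 'a measure) (sphere 0 1) =
      ennreal (DIM('a) * unit_ball_vol DIM('a))"
    by (simp only: emeasure_sphere_measure[OF borel_closed[OF closed_sphere] order.refl] B)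
      (simp add: ennreal_mult flip: ennreal_of_nat_eq_real_of_nat)
  also have "DIM('a) * unit_ball_vol DIM('a) = 2 * pi powr (DIM('a) / 2) / Gamma (DIM('a) / 2)"
  proof -
    have pos: "0 < DIM('a) / (2::real)" by simp
    then have "DIM('a) / (2::real) \<notin> \<int>\<^sub>\<le>\<^sub>0"
      using nonpos_Ints_nonpos by force
    then have "Gamma (DIM('a) / 2 + 1) = DIM('a) / 2 * Gamma (DIM('a) / 2 :: real)"
      by (rule Gamma_plus1)
    then show ?thesis
      unfolding unit_ball_vol_def using Gamma_real_pos[OF pos]
      by (simp only:) (simp add: divide_simps)
  qed
  finally show ?thesis .
qed

lemma finite_measure_sphere_measure: "finite_measure sphere_measure"
  by (rule finite_measureI) (simp add: emeasure_sphere_measure_space)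


definition gvmf3_const :: "nat \<Rightarrow> real \<Rightarrow> real \<Rightarrow> real" where
  "gvmf3_const d \<kappa> \<alpha> =
     inverse (4 * pi powr ((real d - 1) / 2) / Gamma ((real d - 1) / 2) *
       (LINT y:{0..1}|lborel.
          exp (\<kappa> / \<alpha> * y powr \<alpha>) * (1 - y\<^sup>2) powr ((real d - 3) / 2)))"

definition gvmf3_density :: "real \<Rightarrow> real \<Rightarrow> 'a::euclidean_space \<Rightarrow> 'a \<Rightarrow> real" where
  "gvmf3_density \<alpha> \<kappa> \<mu> x =
     gvmf3_const DIM('a) \<kappa> \<alpha> * exp (\<kappa> / \<alpha> * \<bar>\<mu> \<bullet> x\<bar> powr \<alpha>)"


text \<open>
  The value \<open>- \<integral> f log f\<close> as an extended real. Since \<open>ennreal\<close> maps negative reals to \<open>0\<close>, the two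
  integrals are those of the positive and negative part of \<open>- f log f\<close>; points with \<open>f x = 0\<close>
  contribute \<open>0\<close>. On a finite measure the first one is finite, because \<open>- t log t \<le> 1/e\<close>,
  so the difference is never of the form \<open>\<infinity> - \<infinity>\<close> and lies in \<open>[-\<infinity>, \<infinity>)\<close>. (The Bochner integral
  would instead give the value \<open>0\<close> when the entropy is \<open>-\<infinity>\<close>.)
\<close>

definition density_entropy :: "'a measure \<Rightarrow> ('a \<Rightarrow> real) \<Rightarrow> ereal" where
  "density_entropy S f =
     enn2ereal (\<integral>\<^sup>+ x. ennreal (- (f x * ln (f x))) \<partial>S) -
     enn2ereal (\<integral>\<^sup>+ x. ennreal (f x * ln (f x)) \<partial>S)"

text \<open>
  The entropy of a random vector \<open>X\<close> on the sphere having a density; the Radon--Nikodym derivative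
  of its law is one choice of the density, and by \<open>sphere_entropy_eq\<close> the choice is immaterial.
\<close>

definition sphere_entropy :: "'m measure \<Rightarrow> ('m \<Rightarrow> 'a::euclidean_space) \<Rightarrow> ereal" where
  "sphere_entropy M X =
     density_entropy sphere_measure
       (\<lambda>x. enn2real (RN_deriv sphere_measure (distr M sphere_measure X) x))"

lemma sphere_entropy_eq:
  assumes X: "distributed M sphere_measure X (\<lambda>x. ennreal (f x))" and f: "\<And>x. 0 \<le> f x"
  shows "sphere_entropy M X = density_entropy sphere_measure f"
proof -
  interpret finite_measure sphere_measure by (rule finite_measure_sphere_measure)
  have "AE x in sphere_measure.
      ennreal (f x) = RN_deriv sphere_measure (distr M sphere_measure X) x"
    using X by (intro RN_deriv_unique)
      (auto simp: distributed_def)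
  then have ae: "AE x in sphere_measure.
      enn2real (RN_deriv sphere_measure (distr M sphere_measure X) x) = f x"
    by (rule AE_mp) (rule AE_I2, metis enn2real_ennreal f)
  show ?thesis
    unfolding sphere_entropy_def density_entropy_def
    by (intro arg_cong2[where f = "(-)"] arg_cong[where f = enn2ereal] nn_integral_cong_AE;
        rule AE_mp[OF ae]) (auto intro!: AE_I2)
qed

end

theory Submission
  imports Defs
begin

text \<open>
  The density \<open>p\<close> of \<open>Z\<close> is of the form \<open>c * exp (\<theta> * T)\<close> with \<open>\<theta> = \<kappa> / \<alpha>\<close> and
  \<open>T x = \<bar>\<mu> \<bullet> x\<bar> powr \<alpha>\<close>: it belongs to the exponential family whose sufficient statistic is exactly
  the quantity constrained by the moment condition. Hence \<open>ln p = ln c + \<theta> * T\<close>, and for every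
  probability density \<open>f\<close> the cross entropy \<open>- \<integral> f ln p = - ln c - \<theta> \<integral> f T\<close> depends on \<open>f\<close> only
  through the constrained moment. By Gibbs' inequality (\<open>density_entropy_le_cross_entropy\<close>) the
  entropy of \<open>f\<close> is at most this cross entropy, which under the moment condition has the same
  value for \<open>f\<close> as for \<open>p\<close>; and the cross entropy of \<open>p\<close> with itself is the entropy of \<open>Z\<close>.
  This is \<open>exponential_family_max_entropy\<close>, which holds over any measure space; on the sphere its
  integrability assumptions are met because \<open>T\<close> takes values in \<open>[0, 1]\<close> there, and \<open>c > 0\<close>
  because \<open>p\<close> has total mass 1.

  The entropy of \<open>f\<close> may be \<open>-\<infinity>\<close>, so Gibbs' inequality is derived in the extended reals, from a
  pointwise bound by an integrable function (\<open>nn_integral_parts_diff_le\<close>).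
\<close>

text \<open>
  The bound \<open>g\<close> makes the integral of the positive part of \<open>h\<close> finite. So either that of the
  negative part is infinite and the difference is \<open>-\<infinity>\<close>, or \<open>h\<close> is integrable and monotonicity
  of the integral applies.
\<close>

lemma nn_integral_parts_diff_le:
  fixes g h :: "'a \<Rightarrow> real"
  assumes h [measurable]: "h \<in> borel_measurable S" and g: "integrable S g"
    and le: "\<And>x. x \<in> space S \<Longrightarrow> h x \<le> g x"
  shows "enn2ereal (\<integral>\<^sup>+ x. ennreal (h x) \<partial>S) - enn2ereal (\<integral>\<^sup>+ x. ennreal (- h x) \<partial>S)
           \<le> ereal (\<integral>x. g x \<partial>S)"
proof -
  let ?P = "\<integral>\<^sup>+ x. ennreal (h x) \<partial>S" and ?Q = "\<integral>\<^sup>+ x. ennreal (- h x) \<partial>S"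
  have "?P \<le> (\<integral>\<^sup>+ x. ennreal (g x) \<partial>S)"
    by (intro nn_integral_mono ennreal_leI le)
  moreover have "(\<integral>\<^sup>+ x. ennreal (g x) \<partial>S) \<noteq> \<infinity>"
    using g by (simp add: real_integrable_def)
  ultimately have P: "?P \<noteq> \<infinity>"
    by (auto simp: top_unique)
  show ?thesis
  proof (cases "?Q = \<infinity>")
    case True
    have "enn2ereal ?P \<noteq> \<infinity>"
      using P by (metis enn2ereal_eq_top_iff infinity_ennreal_def)
    then show ?thesis
      using True by (cases "enn2ereal ?P") auto
  next
    case False
    then have int: "integrable S h"
      using P by (simp add: real_integrable_def)
    have "enn2ereal ?P - enn2ereal ?Q = ereal (enn2real ?P - enn2real ?Q)"
      using P False by (cases ?P; cases ?Q) auto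
    also have "enn2real ?P - enn2real ?Q = (\<integral>x. h x \<partial>S)"
      using int by (simp add: real_lebesgue_integral_def)
    also have "\<dots> \<le> (\<integral>x. g x \<partial>S)"
      by (intro integral_mono int g le)
    finally show ?thesis by simp
  qed
qed

lemma density_entropy_integrable:
  assumes "integrable S (\<lambda>x. f x * ln (f x))"
  shows "density_entropy S f = ereal (- (\<integral>x. f x * ln (f x) \<partial>S))"
proof -
  let ?P = "\<integral>\<^sup>+ x. ennreal (- (f x * ln (f x))) \<partial>S" and ?Q = "\<integral>\<^sup>+ x. ennreal (f x * ln (f x)) \<partial>S"
  have "?P \<noteq> \<infinity>" "?Q \<noteq> \<infinity>"
    using assms by (simp_all add: real_integrable_def)
  then have "density_entropy S f = ereal (enn2real ?P - enn2real ?Q)"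
    unfolding density_entropy_def by (cases ?P; cases ?Q) auto
  then show ?thesis
    using assms by (simp add: real_lebesgue_integral_def)
qed

text \<open>
  Gibbs' inequality. Integrating \<open>ln t \<le> t - 1\<close> at \<open>t = p x / f x\<close> against \<open>f\<close> gives
  \<open>- f ln f \<le> - f ln p - f + p\<close> pointwise, and the last two terms cancel on integration.
\<close>

lemma density_entropy_le_cross_entropy:
  fixes f p :: "'a \<Rightarrow> real"
  assumes f: "integrable S f" and p: "integrable S p"
    and cross: "integrable S (\<lambda>x. f x * ln (p x))"
    and f_nonneg: "\<And>x. x \<in> space S \<Longrightarrow> 0 \<le> f x" and p_pos: "\<And>x. x \<in> space S \<Longrightarrow> 0 < p x"
    and mass: "(\<integral>x. f x \<partial>S) = (\<integral>x. p x \<partial>S)"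
  shows "density_entropy S f \<le> ereal (- (\<integral>x. f x * ln (p x) \<partial>S))"
proof -
  have [measurable]: "f \<in> borel_measurable S"
    using f by simp
  let ?g = "\<lambda>x. - (f x * ln (p x)) - f x + p x"
  have "- (f x * ln (f x)) \<le> ?g x" if "x \<in> space S" for x
  proof (cases "f x = 0")
    case True
    then show ?thesis using p_pos[OF that] by simp
  next
    case False
    then have fx: "0 < f x" using f_nonneg[OF that] by simp
    have "f x * ln (p x / f x) \<le> f x * (p x / f x - 1)"
      using fx p_pos[OF that] by (intro mult_left_mono ln_le_minus_one) auto
    then show ?thesis
      using fx p_pos[OF that] by (simp add: ln_div algebra_simps)
  qed
  then have "density_entropy S f \<le> ereal (\<integral>x. ?g x \<partial>S)"
    using nn_integral_parts_diff_le[of "\<lambda>x. - (f x * ln (f x))" S ?g] f p cross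
    by (simp add: density_entropy_def)
  also have "(\<integral>x. ?g x \<partial>S) = - (\<integral>x. f x * ln (p x) \<partial>S)"
    using f p cross mass by simp
  finally show ?thesis .
qed

text \<open>
  The moment condition enters only through \<open>\<integral> f ln p = \<integral> p ln p\<close>, as \<open>ln p\<close> is an affine function
  of the statistic \<open>T\<close>.
\<close>

lemma exponential_family_max_entropy:
  fixes f T :: "'a \<Rightarrow> real" and c \<theta> :: real
  defines "p \<equiv> \<lambda>x. c * exp (\<theta> * T x)"
  assumes c: "0 < c"
    and f: "integrable S f" "integrable S (\<lambda>x. f x * T x)" "\<And>x. x \<in> space S \<Longrightarrow> 0 \<le> f x"
    and p: "integrable S p" "integrable S (\<lambda>x. p x * T x)"
    and mass: "(\<integral>x. f x \<partial>S) = (\<integral>x. p x \<partial>S)"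
    and moment: "(\<integral>x. f x * T x \<partial>S) = (\<integral>x. p x * T x \<partial>S)"
  shows "density_entropy S f \<le> density_entropy S p"
proof -
  have ln_p: "ln (p x) = ln c + \<theta> * T x" for x
    using c by (simp add: p_def ln_mult)
  have split: "q x * ln (p x) = ln c * q x + \<theta> * (q x * T x)" for q :: "'a \<Rightarrow> real" and x
    by (simp add: ln_p algebra_simps)
  have cross: "integrable S (\<lambda>x. f x * ln (p x))" "integrable S (\<lambda>x. p x * ln (p x))"
    using f(1,2) p by (simp_all add: split)
  have "density_entropy S f \<le> ereal (- (\<integral>x. f x * ln (p x) \<partial>S))"
    using f(1) p(1) cross(1) f(3) _ mass
    by (rule density_entropy_le_cross_entropy) (use c in \<open>simp_all add: p_def\<close>)
  also have "(\<integral>x. f x * ln (p x) \<partial>S) = (\<integral>x. p x * ln (p x) \<partial>S)"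
    unfolding split using f(1,2) p mass moment by simp
  also have "ereal (- (\<integral>x. p x * ln (p x) \<partial>S)) = density_entropy S p"
    using cross(2) by (rule density_entropy_integrable[symmetric])
  finally show ?thesis .
qed

text \<open>
  A density with values in \<open>[0, \<infinity>]\<close> has finite integral on a probability space, so it is finite
  almost everywhere and may be replaced by a real-valued one.
\<close>

lemma (in prob_space) distributed_real_density:
  assumes "distributed M S X f"
  obtains g :: "'b \<Rightarrow> real" where "distributed M S X (\<lambda>x. ennreal (g x))" "\<And>x. 0 \<le> g x"
proof
  have [measurable]: "f \<in> borel_measurable S"
    using assms by (rule distributed_borel_measurable)
  have "(\<integral>\<^sup>+ x. f x \<partial>S) = (\<integral>\<^sup>+ x. f x * 1 \<partial>S)"
    by simp
  also have "\<dots> = (\<integral>\<^sup>+ x. 1 \<partial>M)"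
    using assms by (rule distributed_nn_integral) simp
  finally have "(\<integral>\<^sup>+ x. f x \<partial>S) \<noteq> \<infinity>"
    by (simp add: emeasure_space_1)
  then have "AE x in S. f x \<noteq> \<infinity>"
    by (intro nn_integral_noteq_infinite) auto
  then have "AE x in S. f x = ennreal (enn2real (f x))"
    by eventually_elim (simp add: less_top)
  then have "density S f = density S (\<lambda>x. ennreal (enn2real (f x)))"
    by (intro density_cong) auto
  then show "distributed M S X (\<lambda>x. ennreal (enn2real (f x)))"
    using assms by (simp add: distributed_def)
qed simp

lemma (in prob_space) distributed_real_density_integral:
  assumes X: "distributed M S X (\<lambda>x. ennreal (f x))" and f: "\<And>x. x \<in> space S \<Longrightarrow> 0 \<le> f x"
  shows "integrable S f" "(\<integral>x. f x \<partial>S) = 1"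
  using distributed_integrable[OF X, of "\<lambda>_. 1"] distributed_integral[OF X, of "\<lambda>_. 1"] f
  by (simp_all add: prob_space)

theorem theorem4p4:
  fixes \<alpha> \<kappa> :: real and \<mu> :: "'a::euclidean_space"
    and M :: "'m measure" and Z :: "'m \<Rightarrow> 'a"
    and N :: "'n measure" and X :: "'n \<Rightarrow> 'a"
  assumes "DIM('a) \<ge> 2" and "\<alpha> > 0" and "\<mu> \<in> sphere 0 1"
    and "prob_space M"
    and "distributed M sphere_measure Z (\<lambda>x. ennreal (gvmf3_density \<alpha> \<kappa> \<mu> x))"
    and "prob_space N"
    and "\<exists>f. distributed N sphere_measure X f"
    and "prob_space.expectation N (\<lambda>\<omega>. \<bar>\<mu> \<bullet> X \<omega>\<bar> powr \<alpha>) =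
         prob_space.expectation M (\<lambda>\<omega>. \<bar>\<mu> \<bullet> Z \<omega>\<bar> powr \<alpha>)"
  shows "sphere_entropy N X \<le> sphere_entropy M Z"
proof -
  interpret M: prob_space M by fact
  interpret N: prob_space N by fact
  note Z = assms(5)
  let ?S = "sphere_measure :: 'a measure"
  define T where "T x = \<bar>\<mu> \<bullet> x\<bar> powr \<alpha>" for x :: 'a
  define c where "c = gvmf3_const DIM('a) \<kappa> \<alpha>"
  have p_eq: "gvmf3_density \<alpha> \<kappa> \<mu> = (\<lambda>x. c * exp (\<kappa> / \<alpha> * T x))"
    by (simp add: gvmf3_density_def c_def T_def fun_eq_iff)
  have T_borel: "T \<in> borel_measurable ?S"
    unfolding T_def
    by (subst measurable_cong_sets[OF sets_sphere_measure refl])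
      (intro measurable_restrict_space1, measurable)
  have T_le: "norm (T x) \<le> 1" if "x \<in> space ?S" for x
  proof -
    have "\<bar>\<mu> \<bullet> x\<bar> \<le> 1"
      using Cauchy_Schwarz_ineq2[of \<mu> x] that assms(3) by simp
    then show ?thesis
      using assms(2) by (simp add: T_def powr_le1)
  qed
  have int_T: "integrable ?S (\<lambda>x. q x * T x)" if "integrable ?S q" for q :: "'a \<Rightarrow> real"
  proof (rule Bochner_Integration.integrable_bound[OF that])
    show "(\<lambda>x. q x * T x) \<in> borel_measurable ?S"
      using that T_borel by simp
    show "AE x in ?S. norm (q x * T x) \<le> norm (q x)"
      using T_le by (intro AE_I2) (simp add: abs_mult mult_left_le)
  qed
  have c: "0 < c"
  proof (rule ccontr)
    \<comment> \<open>Otherwise the density would be \<open>0\<close> everywhere, as \<open>ennreal\<close> truncates negative values.\<close>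
    assume "\<not> 0 < c"
    then have "ennreal (gvmf3_density \<alpha> \<kappa> \<mu> x) = 0" for x
      by (simp add: p_eq ennreal_eq_0_iff mult_nonpos_nonneg)
    then have "(\<integral>\<^sup>+ x. 1 \<partial>M) = 0"
      using distributed_nn_integral[OF Z, of "\<lambda>_. 1"] by simp
    then show False
      by (simp add: M.emeasure_space_1)
  qed
  then have p_nonneg: "0 \<le> gvmf3_density \<alpha> \<kappa> \<mu> x" for x
    by (simp add: p_eq)
  obtain f where X: "distributed N ?S X (\<lambda>x. ennreal (f x))" and f: "\<And>x. 0 \<le> f x"
    using assms(7) N.distributed_real_density by metis
  note mass_f = N.distributed_real_density_integral[OF X f]
  note mass_p = M.distributed_real_density_integral[OF Z p_nonneg]
  have "(\<integral>x. f x * T x \<partial>?S) = (\<integral>x. gvmf3_density \<alpha> \<kappa> \<mu> x * T x \<partial>?S)"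
    using distributed_integral[OF X T_borel] distributed_integral[OF Z T_borel] f p_nonneg assms(8)
    by (simp add: T_def)
  then have "density_entropy ?S f \<le> density_entropy ?S (gvmf3_density \<alpha> \<kappa> \<mu>)"
    using c f mass_f mass_p int_T[OF mass_f(1)] int_T[OF mass_p(1)]
    unfolding p_eq by (intro exponential_family_max_entropy) auto
  then show ?thesis
    using sphere_entropy_eq[OF X f] sphere_entropy_eq[OF Z p_nonneg] by simp
qed

end
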